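(* Let $p>3$ be a prime. Then, in the polynomial ring $\mathbb Z_p[x]$ (congruences meaning coefficientwise congruence), $$\sum_{k=0}^{p-1}\frac{\binom{3k}k\binom{2k}k}{27^k}\left(x^k-\left(\frac p3\right)(1-x)^k\right)\equiv0\pmod{p^2},$$ $$\sum_{k=0}^{p-1}\frac{\binom{4k}{2k}\binom{2k}k}{64^k}\left(x^k-\left(\frac {-2}p\right)(1-x)^k\right)\equiv0\pmod{p^2},$$ $$\sum_{k=0}^{p-1}\frac{\binom{6k}{3k}\binom{3k}k}{432^k}\left(x^k-\left(\frac {-1}p\right)(1-x)^k\right)\equiv0\pmod{p^2}.$$ Also, $$\sum_{k=1}^{p-1}\frac{k\binom{3k}k\binom{2k}k}{27^k}\left(x^{k-1}+\left(\frac p3\right)(1-x)^{k-1}\right)\equiv0\pmod{p^2},$$ $$\sum_{k=1}^{p-1}\frac{k\binom{4k}{2k}\binom{2k}k}{64^k}\left(x^{k-1}+\left(\frac {-2}p\right)(1-x)^{k-1}\right)\equiv0\pmod{p^2},$$ $$\sum_{k=1}^{p-1}\frac{k\binom{6k}{3k}\binom{3k}k}{432^k}\left(x^{k-1}+\left(\frac {-1}p\right)(1-x)^{k-1}\right)\equiv0\pmod{p^2}.$$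
   Context: $\mathbb Z_p$ denotes the ring of $p$-adic integers; $\left(\frac{\cdot}{p}\right)$ is the Legendre symbol and $\left(\frac{p}{3}\right)$ the Legendre symbol modulo $3$. *)

theory Defs
  imports
    "HOL-Number_Theory.Number_Theory"
    "HOL-Computational_Algebra.Polynomial"
    "HOL-Library.Numeral_Type"
begin

text \<open>
  The ring of \<open>p\<close>-adic integers with \<open>p = CARD('p)\<close>, as the inverse limit of the rings
  \<open>\<int>/p\<^sup>n\<int>\<close>; the residue at level \<open>n\<close> is represented by an integer in \<open>{0..<p\<^sup>n}\<close>.
  The class \<open>card2\<close> only demands \<open>p \<ge> 2\<close> (every numeral type \<open>2\<close>, \<open>3\<close>, \<open>5\<close>, and so on, is an
  instance); primality is a hypothesis wherever it is needed.
\<close>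

typedef (overloaded) 'p padic_int =
  "{a :: nat \<Rightarrow> int. \<forall>n. a n \<in> {0..<int CARD('p::card2) ^ n} \<and>
      a (Suc n) mod int CARD('p) ^ n = a n}"
  morphisms padic_res Abs_padic_int
  by (rule exI[of _ "\<lambda>_. 0"]) auto

setup_lifting type_definition_padic_int

lemma padic_level_op:
  fixes q :: int and f :: "int \<Rightarrow> int \<Rightarrow> int"
  assumes "q > 0"
    and f: "\<And>x y x' y' m. [x = x'] (mod m) \<Longrightarrow> [y = y'] (mod m) \<Longrightarrow> [f x y = f x' y'] (mod m)"
    and a: "a (Suc n) mod q ^ n = a n" and b: "b (Suc n) mod q ^ n = b n"
  shows "f (a (Suc n)) (b (Suc n)) mod q ^ Suc n mod q ^ n = f (a n) (b n) mod q ^ n"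
proof -
  have "f (a (Suc n)) (b (Suc n)) mod q ^ Suc n mod q ^ n = f (a (Suc n)) (b (Suc n)) mod q ^ n"
    by (rule mod_mod_cancel) simp
  moreover have "[a (Suc n) = a n] (mod q ^ n)" "[b (Suc n) = b n] (mod q ^ n)"
    using a b by (metis cong_def mod_mod_trivial)+
  ultimately show ?thesis
    using f unfolding cong_def by metis
qed

instantiation padic_int :: (card2) comm_ring_1
begin

lift_definition zero_padic_int :: "'a padic_int" is "\<lambda>_. 0"
  by auto

lift_definition one_padic_int :: "'a padic_int" is "\<lambda>n. 1 mod int CARD('a) ^ n"
  by (auto simp: mod_mod_cancel)

lift_definition plus_padic_int :: "'a padic_int \<Rightarrow> 'a padic_int \<Rightarrow> 'a padic_int"
  is "\<lambda>a b n. (a n + b n) mod int CARD('a) ^ n"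
  by (intro allI conjI padic_level_op[where f = "\<lambda>x y. x + y"]) (auto intro: cong_add)

lift_definition times_padic_int :: "'a padic_int \<Rightarrow> 'a padic_int \<Rightarrow> 'a padic_int"
  is "\<lambda>a b n. (a n * b n) mod int CARD('a) ^ n"
  by (intro allI conjI padic_level_op[where f = "\<lambda>x y. x * y"]) (auto intro: cong_mult)

lift_definition minus_padic_int :: "'a padic_int \<Rightarrow> 'a padic_int \<Rightarrow> 'a padic_int"
  is "\<lambda>a b n. (a n - b n) mod int CARD('a) ^ n"
  by (intro allI conjI padic_level_op[where f = "\<lambda>x y. x - y"]) (auto intro: cong_diff)

lift_definition uminus_padic_int :: "'a padic_int \<Rightarrow> 'a padic_int"
  is "\<lambda>a n. (- a n) mod int CARD('a) ^ n"
  subgoal for a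
    using padic_level_op[of "int CARD('a)" "\<lambda>x _. - x" a _ a]
    by (auto simp: cong_minus_minus_iff)
  done

instance
proof
  fix a b c :: "'a padic_int"
  show "a * b * c = a * (b * c)"
    by transfer (simp add: fun_eq_iff mod_simps mult.assoc)
  show "a * b = b * a"
    by transfer (simp add: fun_eq_iff mult.commute)
  show "1 * a = a"
    by transfer (auto simp: fun_eq_iff mod_simps)
  show "a + b + c = a + (b + c)"
    by transfer (simp add: fun_eq_iff mod_simps add.assoc)
  show "a + b = b + a"
    by transfer (simp add: fun_eq_iff add.commute)
  show "0 + a = a"
    by transfer (auto simp: fun_eq_iff)
  show "- a + a = 0"
    by transfer (simp add: fun_eq_iff mod_simps)
  show "a - b = a + - b"
    by transfer (simp add: fun_eq_iff mod_simps)
  show "(a + b) * c = a * c + b * c"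
    by transfer (simp add: fun_eq_iff mod_simps distrib_right)
  show "(0 :: 'a padic_int) \<noteq> 1"
    by transfer (use one_less_int_card[where 'a='a] in \<open>auto simp: fun_eq_iff intro!: exI[of _ 1]\<close>)
qed

end

text \<open>Quotients \<open>a / b\<close> are meant for units \<open>b\<close> only; \<open>inverse\<close> is set to 0 elsewhere.\<close>

instantiation padic_int :: (card2) inverse
begin

definition inverse_padic_int :: "'a padic_int \<Rightarrow> 'a padic_int"
  where "inverse (x :: 'a padic_int) = (if x dvd 1 then THE y. x * y = 1 else 0)"

definition divide_padic_int :: "'a padic_int \<Rightarrow> 'a padic_int \<Rightarrow> 'a padic_int"
  where "x div y = x * inverse (y :: 'a padic_int)"

instance ..

end

lemma padic_inverse_right:
  fixes x :: "'p::card2 padic_int"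
  assumes "x dvd 1"
  shows "x * inverse x = 1"
proof -
  from assms obtain y where y: "x * y = 1" by (metis dvd_def)
  have "z = y" if "x * z = 1" for z
  proof -
    have "z = (x * y) * z" using y by simp
    also have "\<dots> = (x * z) * y" by (simp only: mult_ac)
    finally show ?thesis using that by simp
  qed
  with y have "x * (THE y. x * y = 1) = 1"
    by (intro theI[of "\<lambda>y. x * y = 1"])
  with assms show ?thesis by (simp add: inverse_padic_int_def)
qed

lemma padic_divide_mult_cancel:
  fixes x y :: "'p::card2 padic_int"
  assumes "y dvd 1"
  shows "x / y * y = x"
proof -
  have "x / y * y = x * (y * inverse y)"
    unfolding divide_padic_int_def by (simp only: mult_ac)
  thus ?thesis using assms by (simp add: padic_inverse_right)
qed

lemma padic_res_of_nat:
  "padic_res (of_nat m :: 'p::card2 padic_int) n = int m mod int CARD('p) ^ n"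
proof (induction m)
  case 0
  then show ?case by (simp add: zero_padic_int.rep_eq)
next
  case (Suc m)
  then show ?case
    by (simp add: plus_padic_int.rep_eq one_padic_int.rep_eq mod_simps)
qed

lemma padic_of_nat_dvd_one:
  assumes "coprime m CARD('p::card2)"
  shows "(of_nat m :: 'p padic_int) dvd 1"
proof -
  let ?q = "int CARD('p)"
  have cop: "coprime (int m) (?q ^ n)" for n
    using assms by simp
  have ex: "\<exists>b. [int m * b = 1] (mod ?q ^ n)" for n
    using cong_solve_coprime_int[OF cop] by blast
  define b where "b n = (SOME b. [int m * b = 1] (mod ?q ^ n)) mod ?q ^ n" for n
  have b: "[int m * b n = 1] (mod ?q ^ n)" for n
    using someI_ex[OF ex[of n]] unfolding b_def by (simp add: cong_def mod_simps)
  have "b (Suc n) mod ?q ^ n = b n" for n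
  proof -
    have "[int m * b (Suc n) = 1] (mod ?q ^ n)"
      by (rule cong_dvd_modulus[OF b]) simp
    hence "[int m * b (Suc n) = int m * b n] (mod ?q ^ n)"
      using b[of n] by (metis cong_def)
    hence "[b (Suc n) = b n] (mod ?q ^ n)"
      using cop by (simp add: cong_mult_lcancel)
    thus ?thesis by (simp add: cong_def b_def)
  qed
  hence res: "padic_res (Abs_padic_int b :: 'p padic_int) = b"
    by (intro Abs_padic_int_inverse) (auto simp: b_def)
  have "padic_res (of_nat m * (Abs_padic_int b :: 'p padic_int)) n = padic_res (1 :: 'p padic_int) n" for n
    using b[of n] by (simp add: times_padic_int.rep_eq one_padic_int.rep_eq padic_res_of_nat res
        mod_mult_left_eq cong_def)
  hence "of_nat m * (Abs_padic_int b :: 'p padic_int) = 1"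
    by (intro padic_res_inject[THEN iffD1] ext)
  thus ?thesis by (intro dvdI) (rule sym)
qed

definition poly_cong :: "'a::comm_ring_1 poly \<Rightarrow> 'a poly \<Rightarrow> 'a \<Rightarrow> bool"
  where "poly_cong f g m \<longleftrightarrow> (\<forall>i. m dvd coeff f i - coeff g i)"

end

theory Submission
  imports Defs
begin

text \<open>
  With \<open>a = -1/3, -1/4, -1/6\<close> the three coefficient sequences are
  \<open>binom(a,k) binom(-1-a,k) = \<Prod>j<k. (j(j+1) - a(a+1)) / (j+1)\<^sup>2\<close>. For a natural number \<open>n < p\<close> in place
  of \<open>a\<close>, the sum \<open>F(n) = \<Sum>k<p. binom(n,k) binom(-1-n,k) (x\<^sup>k - (-1)\<^sup>n (1-x)\<^sup>k)\<close> vanishes exactly: this is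
  the symmetry \<open>P\<^sub>n(-z) = (-1)\<^sup>n P\<^sub>n(z)\<close> of the Legendre polynomials at \<open>z = 1 - 2x\<close>. Write
  \<open>a = r + p t\<close> with \<open>0 \<le> r < p\<close> and keep the sign \<open>(-1)\<^sup>r\<close>. Modulo \<open>p\<^sup>2\<close> the sum is affine in \<open>t\<close>, and it vanishes
  at \<open>t = 0\<close> and at \<open>t = -1\<close>, because \<open>r - p\<close> and \<open>-1 - (r - p) = p - 1 - r\<close> give the same
  coefficients and \<open>p - 1 - r\<close> has the parity of \<open>r\<close>. Hence it vanishes for every \<open>t\<close>. The sign
  \<open>(-1)\<^sup>r\<close> is the Legendre symbol in question, and the second family of congruences consists of
  the derivatives of the first.
\<close>

section \<open>Reflection symmetry of the Legendre polynomials\<close>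

text \<open>The alternating sum is, up to sign, the m-th finite difference of binom(y, n) in y.
  Pascal's rule lets each difference lower n by one; applied to binom(m + 1, j), it also reduces
  order m + 1 to order m at y and y + 1.\<close>

lemma binomial_finite_difference:
  assumes "m \<le> n"
  shows "(\<Sum>j\<le>m. (-1) ^ j * int (m choose j) * int ((y + j) choose n)) = (-1) ^ m * int (y choose (n - m))"
  using assms
proof (induction m arbitrary: y)
  case (Suc m)
  let ?f = "\<lambda>y m. \<Sum>j\<le>m. (-1) ^ j * int (m choose j) * int ((y + j) choose n)"
  have "?f y (Suc m) = ?f y m - ?f (Suc y) m"
  proof -
    have "?f y (Suc m) = int (y choose n) +
        (\<Sum>j\<le>m. (-1) ^ Suc j * int (Suc m choose Suc j) * int ((y + Suc j) choose n))"
      by (subst sum.atMost_Suc_shift) simp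
    also have "\<dots> = int (y choose n) +
        (\<Sum>j\<le>m. (-1) ^ Suc j * int (m choose Suc j) * int ((y + Suc j) choose n)) - ?f (Suc y) m"
      by (simp add: sum.distrib algebra_simps sum_negf sum_subtractf)
    also have "int (y choose n) +
        (\<Sum>j\<le>m. (-1) ^ Suc j * int (m choose Suc j) * int ((y + Suc j) choose n)) =
        (\<Sum>j\<le>Suc m. (-1) ^ j * int (m choose j) * int ((y + j) choose n))"
      by (subst sum.atMost_Suc_shift) simp
    also have "\<dots> = ?f y m" by simp
    finally show ?thesis .
  qed
  also have "\<dots> = (-1) ^ m * (int (y choose (n - m)) - int (Suc y choose (n - m)))"
    using Suc.IH[of y] Suc.IH[of "Suc y"] Suc.prems by (simp only: Suc_leD right_diff_distrib)
  also have "n - m = Suc (n - Suc m)" using Suc.prems by simp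
  finally show ?case by (simp add: Suc.prems)
qed simp

text \<open>Coefficient of x^k in P_n(1 - 2x), where P_n is the Legendre polynomial; it equals
  binom(n,k) binom(-1-n,k).\<close>

definition legendre_coeff :: "nat \<Rightarrow> nat \<Rightarrow> int"
  where "legendre_coeff n k = (-1) ^ k * int (n choose k) * int ((n + k) choose k)"

text \<open>Coefficient form of the symmetry under x -> 1 - x, seen after expanding (1 - x)^k in
  powers of -x.\<close>

lemma legendre_coeff_reflection:
  assumes "i \<le> n"
  shows "(\<Sum>k\<le>n. legendre_coeff n k * int (k choose i)) = (-1) ^ (n + i) * legendre_coeff n i"
proof -
  have "(\<Sum>k\<le>n. legendre_coeff n k * int (k choose i)) = (\<Sum>k=i..n. legendre_coeff n k * int (k choose i))"
    by (intro sum.mono_neutral_right) auto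
  also have "\<dots> = (\<Sum>j\<le>n - i. legendre_coeff n (i + j) * int ((i + j) choose i))"
    using assms
    by (intro sum.reindex_bij_witness[of _ "\<lambda>j. i + j" "\<lambda>k. k - i"]) auto
  \<comment> \<open>Once binom(n, i) is pulled out, what remains is a finite difference of order n -
    i of binom(y, n) at y = n + i.\<close>
  also have "\<dots> = (\<Sum>j\<le>n - i. (-1) ^ i * int (n choose i) *
      ((-1) ^ j * int ((n - i) choose j) * int ((n + i + j) choose n)))"
  proof (intro sum.cong refl)
    fix j assume "j \<in> {..n - i}"
    then have ij: "i + j \<le> n" using assms by auto
    have "(n choose (i + j)) * ((i + j) choose i) = (n choose i) * ((n - i) choose j)"
      using choose_mult[of i "i + j" n] ij by simp
    moreover have "(n + (i + j)) choose (i + j) = (n + i + j) choose n"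
      using binomial_symmetric[of "i + j" "n + (i + j)"] by (simp add: add.assoc)
    ultimately show "legendre_coeff n (i + j) * int ((i + j) choose i) = (-1) ^ i * int (n choose i) *
      ((-1) ^ j * int ((n - i) choose j) * int ((n + i + j) choose n))"
      unfolding legendre_coeff_def
      by (simp add: power_add mult_ac flip: of_nat_mult)
  qed
  also have "\<dots> = (-1) ^ i * int (n choose i) * ((-1) ^ (n - i) * int ((n + i) choose i))"
    using assms by (simp add: binomial_finite_difference flip: sum_distrib_left)
  also have "\<dots> = (-1) ^ (n + i) * legendre_coeff n i"
    using assms unfolding legendre_coeff_def
    by (simp add: power_add power_diff_conv_inverse mult_ac minus_one_power_iff)
  finally show ?thesis .
qed

lemma legendre_reflection:
  fixes x :: "'a::comm_ring_1"
  shows "(\<Sum>k\<le>n. of_int (legendre_coeff n k) * (1 - x) ^ k) =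
    (-1) ^ n * (\<Sum>k\<le>n. of_int (legendre_coeff n k) * x ^ k)"
proof -
  \<comment> \<open>The range i \<le> n includes vanishing terms, so that it is the same for every k
    and the two sums can be swapped.\<close>
  have "(1 - x) ^ k = (\<Sum>i\<le>n. of_nat (k choose i) * (- x) ^ i)" if "k \<le> n" for k
  proof -
    have "(1 - x) ^ k = (\<Sum>i\<le>k. of_nat (k choose i) * (- x) ^ i)"
      using binomial_ring[of "- x" 1 k] by simp
    also have "\<dots> = (\<Sum>i\<le>n. of_nat (k choose i) * (- x) ^ i)"
      using that by (intro sum.mono_neutral_left) (auto simp: binomial_eq_0 not_le)
    finally show ?thesis .
  qed
  then have "(\<Sum>k\<le>n. of_int (legendre_coeff n k) * (1 - x) ^ k) =
      (\<Sum>k\<le>n. \<Sum>i\<le>n. of_int (legendre_coeff n k * int (k choose i)) * (- x) ^ i)"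
    by (intro sum.cong refl) (simp add: sum_distrib_left mult_ac)
  also have "\<dots> = (\<Sum>i\<le>n. of_int (\<Sum>k\<le>n. legendre_coeff n k * int (k choose i)) * (- x) ^ i)"
    by (subst sum.swap) (simp add: sum_distrib_right)
  also have "\<dots> = (\<Sum>i\<le>n. (-1) ^ n * (of_int (legendre_coeff n i) * x ^ i))"
  proof (intro sum.cong refl)
    fix i assume "i \<in> {..n}"
    have "(- x) ^ i = (-1) ^ i * x ^ i" by (rule power_minus)
    moreover have "(-1) ^ i * (-1) ^ i = (1::'a)" by (simp flip: power_add)
    ultimately show "of_int (\<Sum>k\<le>n. legendre_coeff n k * int (k choose i)) * (- x) ^ i =
        (-1) ^ n * (of_int (legendre_coeff n i) * x ^ i)"
      using \<open>i \<in> {..n}\<close>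
      by (simp add: legendre_coeff_reflection power_add mult_ac del: of_int_sum)
  qed
  finally show ?thesis by (simp add: sum_distrib_left)
qed

text \<open>Each factor splits as (j - n)(j + n + 1); the two resulting products are (-1)^k k!
  binom(n,k) and k! binom(n+k,k).\<close>

lemma prod_eq_legendre_coeff:
  "(\<Prod>j<k. int (j * (j + 1)) - int n * (int n + 1)) = fact k ^ 2 * legendre_coeff n k"
proof (induction k)
  case (Suc k)
  have 1: "int (Suc k) * int (n choose Suc k) = (int n - int k) * int (n choose k)"
  proof (cases "k \<le> n")
    case True
    have "Suc k * (n choose Suc k) = (n - k) * (n choose k)"
      by (metis binomial_absorption binomial_absorb_comp)
    then have "int (Suc k * (n choose Suc k)) = int ((n - k) * (n choose k))" by simp
    then show ?thesis using True by (simp only: of_nat_mult of_nat_diff)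
  qed (simp add: binomial_eq_0)
  have 2: "int (Suc k) * int (Suc (n + k) choose Suc k) = (int n + int k + 1) * int ((n + k) choose k)"
    using arg_cong[OF Suc_times_binomial[of k "n + k"], of int] by (simp add: algebra_simps)
  have "fact (Suc k) ^ 2 * legendre_coeff n (Suc k) =
     - (fact k ^ 2 * (-1) ^ k * (int (Suc k) * int (n choose Suc k)) * (int (Suc k) * int (Suc (n + k) choose Suc k)))"
    by (simp only: legendre_coeff_def fact_Suc power2_eq_square) (simp add: algebra_simps)
  also have "\<dots> = (int (k * (k + 1)) - int n * (int n + 1)) * (fact k ^ 2 * legendre_coeff n k)"
    unfolding 1 2 legendre_coeff_def by (simp add: algebra_simps)
  finally show ?case using Suc by (simp add: mult.commute)
qed (simp add: legendre_coeff_def)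

section \<open>The congruence modulo p^2 over a commutative ring\<close>

text \<open>Taylor expansion with D = G'(r). What matters is that one D serves every h: it is used
  below for h = -p and for h = p t.\<close>

lemma poly_first_order:
  fixes G :: "'a::comm_ring_1 poly"
  obtains D where "\<And>h. h ^ 2 dvd poly G (r + h) - poly G r - h * D"
proof -
  have "\<exists>D. \<forall>h. h ^ 2 dvd poly G (r + h) - poly G r - h * D"
  proof (induction G)
    case (pCons c G)
    then obtain D where D: "\<And>h. h ^ 2 dvd poly G (r + h) - poly G r - h * D" by blast
    \<comment> \<open>The new D is the product rule for c + X G at r.\<close>
    have "h ^ 2 dvd poly (pCons c G) (r + h) - poly (pCons c G) r - h * (poly G r + r * D)" for h
    proof -
      have "poly (pCons c G) (r + h) - poly (pCons c G) r - h * (poly G r + r * D) =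
          (r + h) * (poly G (r + h) - poly G r - h * D) + h ^ 2 * D"
        by (simp add: algebra_simps power2_eq_square)
      then show ?thesis using D[of h] by simp
    qed
    then show ?case by blast
  qed (auto intro: exI[of _ 0])
  then show thesis using that by blast
qed

text \<open>The ring is arbitrary so that x may later be a polynomial in a further variable, and
  \<open>c k\<close> is specified through \<open>c k * of_nat (fact k) ^ 2\<close> to avoid
  division.\<close>

lemma square_dvd_truncated_legendre:
  fixes x a t :: "'a::comm_ring_1" and c :: "nat \<Rightarrow> 'a"
  assumes "odd p" and "r < p" and a: "a = of_nat r + of_nat p * t"
    and c: "\<And>k. c k * of_nat (fact k) ^ 2 = (\<Prod>j<k. of_nat (j * (j + 1)) - a * (a + 1))"
    and unit: "(of_nat (fact (p - 1)) :: 'a) dvd 1"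
  shows "of_nat p ^ 2 dvd (\<Sum>k<p. c k * (x ^ k - (-1) ^ r * (1 - x) ^ k))"
proof -
  define q where "q k = (of_nat (fact (p - 1) div fact k) :: 'a)" for k
  define z where "z k = x ^ k - (-1) ^ r * (1 - x) ^ k" for k
  \<comment> \<open>Multiplying by the square of (p - 1)! clears the denominators k!^2 for all k <
    p; \<open>G\<close> is the cleared sum as a polynomial in the parameter a.\<close>
  define G where "G = (\<Sum>k<p. [:q k ^ 2 * z k:] * (\<Prod>j<k. [:of_nat (j * (j + 1)):] - [:0, 1:] * [:1, 1:]))"
  have q: "q k * of_nat (fact k) = of_nat (fact (p - 1))" if "k < p" for k
  proof -
    have "(fact k :: nat) dvd fact (p - 1)" using that by (intro fact_dvd) simp
    then have "fact (p - 1) div fact k * fact k = (fact (p - 1) :: nat)" by simp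
    then show ?thesis unfolding q_def by (metis of_nat_mult)
  qed
  have G: "poly G b = (\<Sum>k<p. q k ^ 2 * z k * (\<Prod>j<k. of_nat (j * (j + 1)) - b * (b + 1)))" for b
    unfolding G_def by (simp add: poly_sum poly_prod algebra_simps)
  \<comment> \<open>For n < p the cut-off at p loses nothing, since binom(n, k) = 0 for k > n, so
    the exact reflection applies.\<close>
  have G_nat: "poly G (of_nat n) = 0" if "n < p" and "(-1) ^ n = ((-1) ^ r :: 'a)" for n
  proof -
    have "poly G (of_nat n) = (\<Sum>k<p. of_nat (fact (p - 1)) ^ 2 * (of_int (legendre_coeff n k) * z k))"
      unfolding G
    proof (intro sum.cong refl)
      fix k assume "k \<in> {..<p}"
      have "(\<Prod>j<k. of_nat (j * (j + 1)) - of_nat n * (of_nat n + 1)) =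
          (of_int (\<Prod>j<k. int (j * (j + 1)) - int n * (int n + 1)) :: 'a)"
        by simp
      also have "\<dots> = of_nat (fact k) ^ 2 * of_int (legendre_coeff n k)"
        unfolding prod_eq_legendre_coeff by (metis of_int_mult of_int_of_nat_eq of_int_power of_nat_fact)
      finally show "q k ^ 2 * z k * (\<Prod>j<k. of_nat (j * (j + 1)) - of_nat n * (of_nat n + 1)) =
          of_nat (fact (p - 1)) ^ 2 * (of_int (legendre_coeff n k) * z k)"
        using q[of k] \<open>k \<in> {..<p}\<close>
        by (simp only: lessThan_iff power_mult_distrib mult_ac flip: q)
    qed
    also have "\<dots> = of_nat (fact (p - 1)) ^ 2 * (\<Sum>k<p. of_int (legendre_coeff n k) * z k)"
      by (simp add: sum_distrib_left)
    also have "(\<Sum>k<p. of_int (legendre_coeff n k) * z k) = (\<Sum>k\<le>n. of_int (legendre_coeff n k) * z k)"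
      using that by (intro sum.mono_neutral_right) (auto simp: legendre_coeff_def binomial_eq_0 not_le)
    also have "\<dots> = (\<Sum>k\<le>n. of_int (legendre_coeff n k) * x ^ k) -
        (-1) ^ n * (\<Sum>k\<le>n. of_int (legendre_coeff n k) * (1 - x) ^ k)"
      unfolding z_def that(2)[symmetric]
      by (simp add: right_diff_distrib sum_subtractf sum_distrib_left mult_ac)
    also have "\<dots> = 0"
      unfolding legendre_reflection by (simp flip: mult.assoc power_add)
    finally show ?thesis by simp
  qed
  have "(-1) ^ (p - 1 - r) = ((-1) ^ r :: 'a)"
    using assms by (auto simp: minus_one_power_iff)
  then have "poly G (of_nat (p - 1 - r)) = 0"
    using assms by (intro G_nat) auto
  moreover have "of_nat (p - 1 - r) = of_nat p - 1 - (of_nat r :: 'a)"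
    using assms by (simp add: of_nat_diff)
  \<comment> \<open>\<open>G\<close> sees its argument b only through b(b + 1), which agrees at r -
    p and p - 1 - r; the zero at p - 1 - r is thus also one at r - p.\<close>
  moreover have "(of_nat r + of_nat p * (-1)) * (of_nat r + of_nat p * (-1) + 1) =
      (of_nat p - 1 - of_nat r) * (of_nat p - 1 - of_nat r + (1::'a))"
    by (simp add: algebra_simps)
  ultimately have G1: "poly G (of_nat r + of_nat p * (-1)) = 0"
    unfolding G by metis
  have G0: "poly G (of_nat r) = 0" using assms by (intro G_nat) auto
  obtain D where D: "\<And>h. h ^ 2 dvd poly G (of_nat r + h) - poly G (of_nat r) - h * D"
    using poly_first_order[of G "of_nat r"] by blast
  \<comment> \<open>Here h = -p. The factor p is kept, as it may be a zero divisor; the linear term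
    for h = p t is a multiple of this same p D.\<close>
  have "of_nat p ^ 2 dvd of_nat p * D"
    using D[of "of_nat p * (-1)"] unfolding G0 G1 by simp
  moreover have "of_nat p ^ 2 dvd poly G a - t * (of_nat p * D)"
    using D[of "of_nat p * t"] unfolding G0 a power_mult_distrib
    by (auto simp: mult_ac dest: dvd_mult_left)
  ultimately have "of_nat p ^ 2 dvd poly G a"
    by (metis dvd_diffD1 dvd_mult diff_add_cancel dvd_add)
  also have "poly G a = of_nat (fact (p - 1)) ^ 2 * (\<Sum>k<p. c k * z k)"
    unfolding G sum_distrib_left
  proof (intro sum.cong refl)
    fix k assume "k \<in> {..<p}"
    then show "q k ^ 2 * z k * (\<Prod>j<k. of_nat (j * (j + 1)) - a * (a + 1)) =
        of_nat (fact (p - 1)) ^ 2 * (c k * z k)"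
      by (simp only: lessThan_iff power_mult_distrib mult_ac flip: q c)
  qed
  finally have main: "of_nat p ^ 2 dvd of_nat (fact (p - 1)) ^ 2 * (\<Sum>k<p. c k * z k)" .
  obtain v where v: "1 = of_nat (fact (p - 1)) * (v :: 'a)" using unit by (elim dvdE)
  have "of_nat (fact (p - 1)) ^ 2 * (\<Sum>k<p. c k * z k) * v ^ 2 =
      (of_nat (fact (p - 1)) * v) ^ 2 * (\<Sum>k<p. c k * z k)"
    by (simp only: power_mult_distrib mult_ac)
  then have "of_nat (fact (p - 1)) ^ 2 * (\<Sum>k<p. c k * z k) * v ^ 2 = (\<Sum>k<p. c k * z k)"
    by (simp only: v[symmetric] power_one mult_1)
  with dvd_mult2[OF main, of "v ^ 2"] show ?thesis unfolding z_def by simp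
qed

section \<open>Lifting to polynomials and their derivatives\<close>

lemma coeff_linear_power_1:
  fixes a b :: "'a::comm_ring_1"
  shows "coeff ([:a, b:] ^ k) 1 = of_nat k * b * a ^ (k - 1)"
proof (induction k)
  case (Suc k)
  have "coeff ([:a, b:] ^ k) 0 = a ^ k" by (simp add: coeff_0_power)
  with Suc show ?case by (cases k) (simp_all add: algebra_simps)
qed simp

text \<open>Carries the hypothesis on c over to constant polynomials; two applications lead from R
  to R[x][y].\<close>

lemma truncated_legendre_hyp_pCons:
  fixes a c :: "'a::comm_ring_1"
  assumes "c * of_nat (fact k) ^ 2 = (\<Prod>j<k. of_nat (j * (j + 1)) - a * (a + 1))"
  shows "[:c:] * of_nat (fact k) ^ 2 = (\<Prod>j<k. of_nat (j * (j + 1)) - [:a:] * ([:a:] + 1))"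
proof -
  have "[:c:] * of_nat (fact k) ^ 2 = [:c * of_nat (fact k) ^ 2:]"
    by (simp add: of_nat_poly poly_const_pow)
  also have "\<dots> = [:\<Prod>j<k. of_nat (j * (j + 1)) - a * (a + 1):]"
    using assms by simp
  also have "\<dots> = (\<Prod>j<k. [:of_nat (j * (j + 1)) - a * (a + 1):])"
  proof (induction k)
    case (Suc k)
    then show ?case
      by (simp only: prod.lessThan_Suc mult.commute flip: Suc) (simp add: mult.commute)
  qed (simp add: one_pCons)
  also have "\<dots> = (\<Prod>j<k. of_nat (j * (j + 1)) - [:a:] * ([:a:] + 1))"
    unfolding of_nat_poly one_pCons by (simp add: mult.commute)
  finally show ?thesis .
qed

lemma of_nat_dvd_one_poly:
  assumes "(of_nat n :: 'a::comm_ring_1) dvd 1"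
  shows "(of_nat n :: 'a poly) dvd 1"
proof -
  from assms obtain v :: 'a where "1 = of_nat n * v" by (elim dvdE)
  then have "(1 :: 'a poly) = of_nat n * [:v:]" by (simp add: of_nat_poly one_pCons mult.commute)
  then show ?thesis by (rule dvdI)
qed

lemma of_nat_power_dvd_coeff:
  assumes "(of_nat n ^ m :: 'a::comm_ring_1 poly) dvd f"
  shows "of_nat n ^ m dvd coeff f i"
proof -
  from assms obtain g where "f = of_nat n ^ m * g" by (elim dvdE)
  then have "coeff f i = of_nat n ^ m * coeff g i" by (simp add: of_nat_poly poly_const_pow)
  then show ?thesis by simp
qed

lemma truncated_legendre_poly_cong:
  fixes x :: "'a::comm_ring_1 poly" and a t :: 'a and c :: "nat \<Rightarrow> 'a"
  assumes "odd p" and "r < p" and a: "a = of_nat r + of_nat p * t"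
    and c: "\<And>k. c k * of_nat (fact k) ^ 2 = (\<Prod>j<k. of_nat (j * (j + 1)) - a * (a + 1))"
    and unit: "(of_nat (fact (p - 1)) :: 'a) dvd 1"
  shows "poly_cong (\<Sum>k = 0..p - 1. smult (c k) (x ^ k - of_int ((-1) ^ r) * (1 - x) ^ k)) 0 (of_nat p ^ 2)"
    and "poly_cong (\<Sum>k = 1..p - 1. smult (of_nat k * c k) (x ^ (k - 1) + of_int ((-1) ^ r) * (1 - x) ^ (k - 1)))
      0 (of_nat p ^ 2)"
proof -
  \<comment> \<open>Over \<open>R[x][y]\<close> at the point \<open>x + y\<close>, the coefficient of \<open>y\<close> is the derivative in \<open>x\<close>.\<close>
  define S where "S = (\<Sum>k<p. [:[:c k:]:] * ([:x, 1:] ^ k - (-1) ^ r * (1 - [:x, 1:]) ^ k))"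
  have "of_nat p ^ 2 dvd S"
    unfolding S_def
  proof (rule square_dvd_truncated_legendre[where a = "[:[:a:]:]" and t = "[:[:t:]:]"])
    show "[:[:a:]:] = of_nat r + of_nat p * [:[:t:]:]"
      by (simp add: a of_nat_poly)
    show "[:[:c k:]:] * of_nat (fact k) ^ 2 =
        (\<Prod>j<k. of_nat (j * (j + 1)) - [:[:a:]:] * ([:[:a:]:] + 1))" for k
      by (intro truncated_legendre_hyp_pCons c)
    show "(of_nat (fact (p - 1)) :: 'a poly poly) dvd 1"
      by (intro of_nat_dvd_one_poly unit)
  qed fact+
  then have dvd: "of_nat p ^ 2 dvd coeff (coeff S i) j" for i j
    by (intro of_nat_power_dvd_coeff)
  have sign: "(-1) ^ r * q = smult ((-1) ^ r) q" for q :: "'a poly poly"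
    by (cases "even r") auto
  have sign': "of_int ((-1) ^ r) = ((-1) ^ r :: 'a poly)" by simp
  \<comment> \<open>The slope -1 in y is what turns the minus sign of the first family into the plus
    sign of the second.\<close>
  have one: "1 - [:x, 1:] = [:1 - x, -1:]" by (simp add: one_pCons)
  have c0: "coeff S 0 = (\<Sum>k = 0..p - 1. smult (c k) (x ^ k - of_int ((-1) ^ r) * (1 - x) ^ k))"
    using \<open>r < p\<close> unfolding S_def sign one sign'
    by (intro trans[OF coeff_sum] sum.cong) (auto simp: coeff_0_power)
  have "coeff S 1 = (\<Sum>k<p. smult (of_nat k * c k) (x ^ (k - 1) + of_int ((-1) ^ r) * (1 - x) ^ (k - 1)))"
    unfolding S_def sign one sign' coeff_sum
    by (intro sum.cong refl)
      (simp add: coeff_linear_power_1 of_nat_poly smult_add_right algebra_simps del: One_nat_def)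
  \<comment> \<open>The term k = 0, where \<open>k - 1\<close> is truncated, drops out because of
    its factor k.\<close>
  also have "\<dots> = (\<Sum>k = 1..p - 1. smult (of_nat k * c k) (x ^ (k - 1) + of_int ((-1) ^ r) * (1 - x) ^ (k - 1)))"
    using \<open>r < p\<close> by (intro sum.mono_neutral_right) (auto simp: not_le)
  finally have c1: "coeff S 1 = \<dots>" .
  show "poly_cong (\<Sum>k = 0..p - 1. smult (c k) (x ^ k - of_int ((-1) ^ r) * (1 - x) ^ k)) 0 (of_nat p ^ 2)"
    unfolding poly_cong_def c0[symmetric] using dvd by simp
  show "poly_cong (\<Sum>k = 1..p - 1. smult (of_nat k * c k) (x ^ (k - 1) + of_int ((-1) ^ r) * (1 - x) ^ (k - 1)))
      0 (of_nat p ^ 2)"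
    unfolding poly_cong_def c1[symmetric] using dvd by simp
qed

section \<open>Specialisation to a = -1/d in the p-adic integers\<close>

text \<open>The equation d r + 1 = p s says that r is the residue of a = -1/d modulo p, with t =
  -s/d. The base d^2 e combines the d^2 that clears a(a + 1) with the constant e in the
  factorisation of \<open>N k\<close>.\<close>

lemma padic_hypergeometric_poly_cong:
  fixes x :: "'p::card2 padic_int poly" and N :: "nat \<Rightarrow> nat"
  assumes p: "prime p" "p > 3" "CARD('p) = p"
    and r: "r < p" "d * r + 1 = p * s" and "d > 0"
    and e: "coprime e p"
    and N: "\<And>k. N k * fact k ^ 2 = e ^ k * (\<Prod>j<k. (d * j + 1) * (d * j + d - 1))"
  shows "poly_cong (\<Sum>k = 0..p - 1. smult (of_nat (N k) / of_nat (d ^ 2 * e) ^ k)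
      (x ^ k - of_int ((-1) ^ r) * (1 - x) ^ k)) 0 (of_nat p ^ 2)" (is ?A)
    and "poly_cong (\<Sum>k = 1..p - 1. smult (of_nat (k * N k) / of_nat (d ^ 2 * e) ^ k)
      (x ^ (k - 1) + of_int ((-1) ^ r) * (1 - x) ^ (k - 1))) 0 (of_nat p ^ 2)" (is ?B)
proof -
  define M where "M = d ^ 2 * e"
  define c where "c k = (of_nat (N k) / of_nat M ^ k :: 'p padic_int)" for k
  have "coprime d p"
  proof (rule coprimeI)
    fix g assume "g dvd d" "g dvd p"
    then have "g dvd d * r + 1" "g dvd d * r" using r by simp_all
    then show "is_unit g" using dvd_add_right_iff by blast
  qed
  then have "(of_nat d :: 'p padic_int) dvd 1" using p by (intro padic_of_nat_dvd_one) simp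
  then obtain w :: "'p padic_int" where w: "1 = of_nat d * w" by (elim dvdE)
  have "coprime (M ^ k) p" for k
    using \<open>coprime d p\<close> e by (simp add: M_def)
  then have M: "(of_nat (M ^ k) :: 'p padic_int) dvd 1" for k
    using p by (intro padic_of_nat_dvd_one) simp
  have fact_unit: "(of_nat (fact (p - 1)) :: 'p padic_int) dvd 1"
    using p prime_dvd_fact_iff[of p "p - 1"]
    by (intro padic_of_nat_dvd_one) (auto simp: coprime_commute intro!: prime_imp_coprime)
  have a: "- w = of_nat r + of_nat p * (- (of_nat s * w))"
  proof -
    have "of_nat p * (of_nat s * w) = of_nat (d * r + 1) * w"
      unfolding r by (simp add: mult_ac)
    also have "\<dots> = of_nat r * (of_nat d * w) + w" by (simp add: algebra_simps)
    finally show ?thesis by (simp flip: w)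
  qed
  \<comment> \<open>For a = -1/d one has -a(a + 1) = (d - 1)/d^2, and d^2 j(j + 1) + d - 1 = (d j +
    1)(d j + d - 1).\<close>
  have factor: "of_nat M * (of_nat (j * (j + 1)) - (- w) * (- w + 1)) =
      (of_nat e * of_nat ((d * j + 1) * (d * j + d - 1)) :: 'p padic_int)" for j
  proof -
    have "of_nat M * (of_nat (j * (j + 1)) - (- w) * (- w + 1)) =
        of_nat e * (of_nat d ^ 2 * of_nat (j * (j + 1)) + (of_nat d * w) * (of_nat d - of_nat d * w))"
      by (simp add: M_def algebra_simps power2_eq_square)
    also have "\<dots> = of_nat e * ((of_nat d * of_nat j + 1) * (of_nat d * of_nat j + of_nat d - 1))"
      unfolding w[symmetric] by (simp add: algebra_simps power2_eq_square)
    also have "\<dots> = of_nat e * of_nat ((d * j + 1) * (d * j + d - 1))"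
      using \<open>d > 0\<close> by (simp add: of_nat_diff algebra_simps)
    finally show ?thesis .
  qed
  have c: "c k * of_nat (fact k) ^ 2 = (\<Prod>j<k. of_nat (j * (j + 1)) - (- w) * (- w + 1))" (is "_ = ?W") for k
  proof -
    have "of_nat (M ^ k) * (c k * of_nat (fact k) ^ 2) = (of_nat (N k * fact k ^ 2) :: 'p padic_int)"
    proof -
      have "c k * of_nat (M ^ k) = of_nat (N k)"
        using padic_divide_mult_cancel[OF M[of k], of "of_nat (N k)"] unfolding c_def of_nat_power .
      moreover have "of_nat (M ^ k) * (c k * of_nat (fact k) ^ 2) = c k * of_nat (M ^ k) * of_nat (fact k) ^ 2"
        by (simp only: mult_ac)
      ultimately show ?thesis by (simp only: of_nat_mult of_nat_power)
    qed
    also have "\<dots> = (\<Prod>j<k. of_nat e * of_nat ((d * j + 1) * (d * j + d - 1)))"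
      unfolding N by (simp only: of_nat_mult of_nat_power of_nat_prod prod.distrib prod_constant card_lessThan)
    also have "\<dots> = of_nat (M ^ k) * ?W"
      unfolding factor[symmetric] by (simp only: of_nat_power prod.distrib prod_constant card_lessThan)
    finally have eq: "of_nat (M ^ k) * (c k * of_nat (fact k) ^ 2) = of_nat (M ^ k) * ?W" .
    have cancel: "inverse (of_nat (M ^ k)) * (of_nat (M ^ k) * b) = b" for b :: "'p padic_int"
    proof -
      have "inverse (of_nat (M ^ k)) * (of_nat (M ^ k) * b) = of_nat (M ^ k) * inverse (of_nat (M ^ k)) * b"
        by (simp only: mult_ac)
      then show ?thesis by (simp only: padic_inverse_right[OF M] mult_1)
    qed
    show ?thesis
      using arg_cong[OF eq, of "\<lambda>b. inverse (of_nat (M ^ k)) * b"] unfolding cancel .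
  qed
  have "odd p" using p prime_odd_nat by simp
  note cong = truncated_legendre_poly_cong[OF \<open>odd p\<close> \<open>r < p\<close> a c fact_unit, of x]
  show ?A using cong(1) unfolding c_def M_def .
  have "of_nat (k * N k) / of_nat (d ^ 2 * e) ^ k = of_nat k * c k" for k
    by (simp add: c_def M_def divide_padic_int_def mult_ac)
  then show ?B using cong(2) by simp
qed

section \<open>The three binomial products as products of linear factors\<close>

lemma fact_multiple_Suc:
  "(fact (2 * Suc k) :: nat) = (2 * k + 2) * (2 * k + 1) * fact (2 * k)"
  "(fact (3 * Suc k) :: nat) = (3 * k + 3) * (3 * k + 2) * (3 * k + 1) * fact (3 * k)"
  "(fact (4 * Suc k) :: nat) = (4 * k + 4) * (4 * k + 3) * (4 * k + 2) * (4 * k + 1) * fact (4 * k)"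
  "(fact (6 * Suc k) :: nat) =
    (6 * k + 6) * (6 * k + 5) * (6 * k + 4) * (6 * k + 3) * (6 * k + 2) * (6 * k + 1) * fact (6 * k)"
proof -
  have m: "2 * Suc k = Suc (Suc (2 * k))" "3 * Suc k = Suc (Suc (Suc (3 * k)))"
    "4 * Suc k = Suc (Suc (Suc (Suc (4 * k))))" "6 * Suc k = Suc (Suc (Suc (Suc (Suc (Suc (6 * k))))))"
    by simp_all
  show "(fact (2 * Suc k) :: nat) = (2 * k + 2) * (2 * k + 1) * fact (2 * k)"
    "(fact (3 * Suc k) :: nat) = (3 * k + 3) * (3 * k + 2) * (3 * k + 1) * fact (3 * k)"
    "(fact (4 * Suc k) :: nat) = (4 * k + 4) * (4 * k + 3) * (4 * k + 2) * (4 * k + 1) * fact (4 * k)"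
    "(fact (6 * Suc k) :: nat) =
      (6 * k + 6) * (6 * k + 5) * (6 * k + 4) * (6 * k + 3) * (6 * k + 2) * (6 * k + 1) * fact (6 * k)"
    unfolding m fact_Suc of_nat_id 
    by (simp_all only: Suc_eq_plus1 add.assoc mult.assoc add_numeral_special arith_simps)
qed

text \<open>The binomial product is (3k)!/k!^3. The multiples of 3 in (3k)! contribute 3^k k!,
  leaving the residue classes 1 and 2 modulo 3.\<close>

lemma binomial_3_2_factor:
  "(3 * k choose k) * (2 * k choose k) * fact k ^ 2 = 3 ^ k * (\<Prod>j<k. (3 * j + 1) * (3 * j + 3 - 1 :: nat))"
proof -
  let ?P = "\<lambda>k. 3 ^ k * (\<Prod>j<k. (3 * j + 1) * (3 * j + 3 - 1 :: nat))"
  have 1: "fact (3 * k) = fact k * ?P k"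
  proof (induction k)
    case (Suc k)
    have "3 * k + 3 - 1 = 3 * k + 2" by simp
    then have P: "?P (Suc k) = 3 * ((3 * k + 1) * (3 * k + 2)) * ?P k"
      by (simp only: prod.lessThan_Suc power_Suc mult_ac)
    have F: "(fact (Suc k) :: nat) = (k + 1) * fact k" by simp
    have "(3 * k + 3) * (3 * k + 2) * (3 * k + 1) * (f * q) =
        (k + 1) * f * (3 * ((3 * k + 1) * (3 * k + 2)) * q)" for f q :: nat
      by (simp add: algebra_simps)
    then show ?case unfolding P F fact_multiple_Suc Suc .
  qed simp
  have 2: "fact k * fact (2 * k) * (3 * k choose k) = (fact (3 * k) :: nat)"
    using binomial_fact_lemma[of k "3 * k"] by simp
  have 3: "fact k * fact k * (2 * k choose k) = (fact (2 * k) :: nat)"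
    using binomial_fact_lemma[of k "2 * k"] by simp
  have "fact k * ((3 * k choose k) * (2 * k choose k) * fact k ^ 2) =
      (fact k * (fact k * fact k * (2 * k choose k)) * (3 * k choose k) :: nat)"
    by (simp add: power2_eq_square)
  also have "\<dots> = fact k * ?P k" unfolding 3 2 1 ..
  finally show ?thesis by simp
qed

text \<open>The binomial product is (4k)!/((2k)! k!^2). The even factors of (4k)! contribute 4^k
  (2k)!, leaving the classes 1 and 3 modulo 4.\<close>

lemma binomial_4_2_factor:
  "(4 * k choose (2 * k)) * (2 * k choose k) * fact k ^ 2 =
    4 ^ k * (\<Prod>j<k. (4 * j + 1) * (4 * j + 4 - 1 :: nat))"
proof -
  let ?P = "\<lambda>k. 4 ^ k * (\<Prod>j<k. (4 * j + 1) * (4 * j + 4 - 1 :: nat))"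
  have 1: "fact (4 * k) = fact (2 * k) * ?P k"
  proof (induction k)
    case (Suc k)
    have "4 * k + 4 - 1 = 4 * k + 3" by simp
    then have P: "?P (Suc k) = 4 * ((4 * k + 1) * (4 * k + 3)) * ?P k"
      by (simp only: prod.lessThan_Suc power_Suc mult_ac)
    have "(4 * k + 4) * (4 * k + 3) * (4 * k + 2) * (4 * k + 1) * (f * q) =
        (2 * k + 2) * (2 * k + 1) * f * (4 * ((4 * k + 1) * (4 * k + 3)) * q)" for f q :: nat
      by (simp add: algebra_simps)
    then show ?case unfolding P fact_multiple_Suc Suc .
  qed simp
  have 2: "fact (2 * k) * fact (2 * k) * (4 * k choose (2 * k)) = (fact (4 * k) :: nat)"
    using binomial_fact_lemma[of "2 * k" "4 * k"] by simp
  have 3: "fact k * fact k * (2 * k choose k) = (fact (2 * k) :: nat)"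
    using binomial_fact_lemma[of k "2 * k"] by simp
  have "fact (2 * k) * ((4 * k choose (2 * k)) * (2 * k choose k) * fact k ^ 2) =
      (fact (2 * k) * (fact k * fact k * (2 * k choose k)) * (4 * k choose (2 * k)) :: nat)"
    by (simp add: power2_eq_square)
  also have "\<dots> = fact (2 * k) * ?P k" unfolding 3 2 1 ..
  finally show ?thesis by simp
qed

lemma binomial_6_3_factor:
  "(6 * k choose (3 * k)) * (3 * k choose k) * fact k ^ 2 =
    12 ^ k * (\<Prod>j<k. (6 * j + 1) * (6 * j + 6 - 1 :: nat))"
proof -
  let ?P = "\<lambda>k. 12 ^ k * (\<Prod>j<k. (6 * j + 1) * (6 * j + 6 - 1 :: nat))"
  \<comment> \<open>Inclusion-exclusion in (6k)!: multiples of 2 give 8^k (3k)!, multiples of 3 give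
    9^k (2k)!, and the multiples of 6, counted twice, give 6^k k!. Hence the constant 12 = 8 * 9 / 6
    and the k! on the left.\<close>
  have 1: "fact (6 * k) * fact k = fact (3 * k) * fact (2 * k) * ?P k"
  proof (induction k)
    case (Suc k)
    have "6 * k + 6 - 1 = 6 * k + 5" by simp
    then have P: "?P (Suc k) = 12 * ((6 * k + 1) * (6 * k + 5)) * ?P k"
      by (simp only: prod.lessThan_Suc power_Suc mult_ac)
    have F: "(fact (Suc k) :: nat) = (k + 1) * fact k" by simp
    have "(6 * k + 6) * (6 * k + 5) * (6 * k + 4) * (6 * k + 3) * (6 * k + 2) * (6 * k + 1) * f * ((k + 1) * g) =
        (3 * k + 3) * (3 * k + 2) * (3 * k + 1) * u * ((2 * k + 2) * (2 * k + 1) * v) *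
        (12 * ((6 * k + 1) * (6 * k + 5)) * q)" if "f * g = u * v * q" for f g u v q :: nat
    proof -
      have F: "(fact (Suc k) :: nat) = (k + 1) * fact k" by simp
    have "(6 * k + 6) * (6 * k + 5) * (6 * k + 4) * (6 * k + 3) * (6 * k + 2) * (6 * k + 1) * (k + 1) =
          (3 * k + 3) * (3 * k + 2) * (3 * k + 1) * ((2 * k + 2) * (2 * k + 1)) * (12 * ((6 * k + 1) * (6 * k + 5)))"
        by (simp add: algebra_simps)
      from arg_cong2[OF this that, of "(*)"] show ?thesis by (simp only: mult_ac)
    qed
    from this[OF Suc] show ?case unfolding P F fact_multiple_Suc .
  qed simp
  have 2: "fact (3 * k) * fact (3 * k) * (6 * k choose (3 * k)) = (fact (6 * k) :: nat)"
    using binomial_fact_lemma[of "3 * k" "6 * k"] by simp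
  have 3: "fact k * fact (2 * k) * (3 * k choose k) = (fact (3 * k) :: nat)"
    using binomial_fact_lemma[of k "3 * k"] by simp
  have "fact (3 * k) * fact (2 * k) * ((6 * k choose (3 * k)) * (3 * k choose k) * fact k ^ 2) =
      (fact (3 * k) * (fact k * fact (2 * k) * (3 * k choose k)) * (6 * k choose (3 * k)) * fact k :: nat)"
    by (simp add: power2_eq_square)
  also have "\<dots> = fact (3 * k) * fact (2 * k) * ?P k" unfolding 3 2 1 ..
  finally show ?thesis by simp
qed

section \<open>Evaluation of the Legendre symbols\<close>

text \<open>Euler's criterion gives the symbol modulo p, and 0, 1, -1 are distinct modulo p because
  p > 2.\<close>

lemma Legendre_eq_minus_one_power:
  assumes "prime p" "2 < p" and "[a ^ ((p - 1) div 2) = (-1) ^ m] (mod int p)"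
  shows "Legendre a (int p) = (-1) ^ m"
proof -
  have "[Legendre a (int p) = (-1) ^ m] (mod int p)"
    using euler_criterion[OF assms(1,2)] assms(3) cong_trans by blast
  moreover have "Legendre a (int p) \<in> {0, 1, -1}" by (simp add: Legendre_def)
  moreover have "(-1 :: int) ^ m \<in> {1, -1}" by (simp add: minus_one_power_iff)
  moreover have "\<not> int p dvd 1" "\<not> int p dvd 2" "\<not> int p dvd - 2" "\<not> int p dvd -1"
    using assms(2) zdvd_imp_le[of "int p" 1] zdvd_imp_le[of "int p" 2] by auto
  ultimately show ?thesis by (auto simp: cong_iff_dvd_diff)
qed

lemma Legendre_minus_one:
  assumes "prime p" "2 < p"
  shows "Legendre (-1) (int p) = (-1) ^ ((p - 1) div 2)"
  by (intro Legendre_eq_minus_one_power assms cong_refl)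

lemma Legendre_minus_two:
  assumes "prime p" "2 < p"
  shows "Legendre (-2) (int p) = (-1) ^ (p div 4)"
proof -
  have "\<not> int p dvd 2" using assms(2) zdvd_imp_le[of "int p" 2] by auto
  then interpret GAUSS p 2
    using assms by unfold_locales (auto simp: cong_0_iff)
  define h where "h = (p - 1) div 2"
  have h: "p = 2 * h + 1" using odd_p unfolding h_def by presburger
  have h': "int p = 2 * int h + 1" unfolding h by simp
  have half: "(int p - 1) div 2 = int h" unfolding h by simp
  \<comment> \<open>Gauss's lemma for 2: doubling x \<le> h stays below p = 2h + 1, so nothing is
    reduced, and 2x exceeds h exactly when x > h div 2.\<close>
  have "C = (\<lambda>x. x * 2) ` A"
    unfolding C_def B_def image_image by (intro image_cong refl) (auto simp: A_def half h' intro!: mod_pos_pos_trivial)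
  then have "E = (\<lambda>x. x * 2) ` {int (h div 2)<..int h}"
    unfolding E_def half by (auto simp: A_def half)
  then have "card E = h - h div 2"
    by (simp add: card_image inj_on_def)
  then have two: "[2 ^ h = (-1) ^ (h - h div 2)] (mod int p)"
    using pre_gauss_lemma unfolding half by simp
  have "(-2 :: int) ^ h = (-1) ^ h * 2 ^ h" by (rule power_minus)
  moreover have "(-1 :: int) ^ h * (-1) ^ (h - h div 2) = (-1) ^ (p div 4)"
  proof -
    have "p div 4 = h div 2" unfolding h by simp
    moreover have "even (h + (h - h div 2)) \<longleftrightarrow> even (h div 2)" by presburger
    ultimately show ?thesis unfolding power_add[symmetric] by (simp only: minus_one_power_iff)
  qed
  ultimately have "[(-2) ^ h = (-1) ^ (p div 4)] (mod int p)"
    using cong_scalar_left[OF two, of "(-1) ^ h"] by simp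
  then show ?thesis
    using assms unfolding h_def by (intro Legendre_eq_minus_one_power)
qed

lemma Legendre_mod_three:
  "Legendre a 3 = (if a mod 3 = 0 then 0 else if a mod 3 = 1 then 1 else -1)"
proof -
  have "QuadRes 3 a \<longleftrightarrow> a mod 3 = 0 \<or> a mod 3 = 1"
  proof
    assume "QuadRes 3 a"
    then obtain y where y: "y ^ 2 mod 3 = a mod 3" by (auto simp: QuadRes_def cong_def)
    have "y mod 3 \<in> {0, 1, 2}" by auto
    moreover have "y ^ 2 mod 3 = (y mod 3) ^ 2 mod 3" by (simp add: power_mod)
    ultimately show "a mod 3 = 0 \<or> a mod 3 = 1" using y by auto
  next
    assume "a mod 3 = 0 \<or> a mod 3 = 1"
    then show "QuadRes 3 a"
      by (auto simp: QuadRes_def cong_def intro: exI[of _ 0] exI[of _ 1])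
  qed
  then show ?thesis by (auto simp: Legendre_def cong_def)
qed

section \<open>The residue r of -1/d modulo p and its parity\<close>

text \<open>Here r = (p s - 1)/3 with s = 1 or 2 according to p mod 3. Splitting modulo 6 also fixes
  the parity of r.\<close>

lemma minus_third_residue:
  assumes "prime p" "p > 3"
  obtains r s where "r < p" "3 * r + 1 = p * s" "Legendre (int p) 3 = (-1) ^ r"
proof -
  have "odd p" "\<not> 3 dvd p"
    using assms prime_odd_nat primes_dvd_imp_eq[of 3 p] by auto
  then have "p mod 6 = 1 \<or> p mod 6 = 5" by presburger
  then show thesis
  proof
    assume "p mod 6 = 1"
    then obtain m where "p = 6 * m + 1" by (metis mult_div_mod_eq)
    then have "int p mod 3 = 1" by presburger
    with \<open>p = 6 * m + 1\<close> show ?thesis using that[of "2 * m" 1] by (simp add: Legendre_mod_three)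
  next
    assume "p mod 6 = 5"
    then obtain m where "p = 6 * m + 5" by (metis mult_div_mod_eq)
    then have "int p mod 3 = 2" by presburger
    with \<open>p = 6 * m + 5\<close> show ?thesis using that[of "4 * m + 3" 2] by (simp add: Legendre_mod_three)
  qed
qed

lemma minus_fourth_residue:
  assumes "prime p" "p > 3"
  obtains r s where "r < p" "4 * r + 1 = p * s" "Legendre (- 2) (int p) = (-1) ^ r"
proof -
  have L: "Legendre (- 2) (int p) = (-1) ^ (p div 4)"
    using assms by (intro Legendre_minus_two) auto
  have "odd p" using assms prime_odd_nat by simp
  then have "p mod 4 = 1 \<or> p mod 4 = 3" by presburger
  then show thesis
  proof
    assume "p mod 4 = 1"
    then obtain m where "p = 4 * m + 1" by (metis mult_div_mod_eq)
    moreover from this have "p div 4 = m" by simp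
    ultimately show ?thesis using that[of m 1] L by simp
  next
    assume "p mod 4 = 3"
    then obtain m where "p = 4 * m + 3" by (metis mult_div_mod_eq)
    \<comment> \<open>r = (3p - 1)/4 has the parity of m = p div 4.\<close>
    then show ?thesis using that[of "3 * m + 2" 3] L by (simp add: minus_one_power_iff)
  qed
qed

lemma minus_sixth_residue:
  assumes "prime p" "p > 3"
  obtains r s where "r < p" "6 * r + 1 = p * s" "Legendre (- 1) (int p) = (-1) ^ r"
proof -
  have L: "Legendre (- 1) (int p) = (-1) ^ ((p - 1) div 2)"
    using assms by (intro Legendre_minus_one) auto
  have "odd p" "\<not> 3 dvd p"
    using assms prime_odd_nat primes_dvd_imp_eq[of 3 p] by auto
  then have "p mod 6 = 1 \<or> p mod 6 = 5" by presburger
  then show thesis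
  proof
    assume "p mod 6 = 1"
    then obtain m where "p = 6 * m + 1" by (metis mult_div_mod_eq)
    then show ?thesis using that[of m 1] L by (simp add: minus_one_power_iff)
  next
    assume "p mod 6 = 5"
    then obtain m where "p = 6 * m + 5" by (metis mult_div_mod_eq)
    \<comment> \<open>r = (5p - 1)/6 and (p - 1)/2 = 3m + 2 both have the parity of m.\<close>
    then show ?thesis using that[of "5 * m + 4" 5] L by (simp add: minus_one_power_iff)
  qed
qed

section \<open>The cases d = 3, 4, 6 combined\<close>

theorem theorem1p5:
  fixes p :: nat and x :: "'p::card2 padic_int poly"
  assumes "prime p" and "p > 3" and "CARD('p) = p" and "x = [:0, 1:]"
  shows
    "poly_cong
      (\<Sum>k = 0..p - 1. smult (of_nat ((3 * k choose k) * (2 * k choose k)) / 27 ^ k)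
        (x ^ k - of_int (Legendre (int p) 3) * (1 - x) ^ k))
      0 (of_nat p ^ 2) \<and>
    poly_cong
      (\<Sum>k = 0..p - 1. smult (of_nat ((4 * k choose (2 * k)) * (2 * k choose k)) / 64 ^ k)
        (x ^ k - of_int (Legendre (- 2) (int p)) * (1 - x) ^ k))
      0 (of_nat p ^ 2) \<and>
    poly_cong
      (\<Sum>k = 0..p - 1. smult (of_nat ((6 * k choose (3 * k)) * (3 * k choose k)) / 432 ^ k)
        (x ^ k - of_int (Legendre (- 1) (int p)) * (1 - x) ^ k))
      0 (of_nat p ^ 2) \<and>
    poly_cong
      (\<Sum>k = 1..p - 1. smult (of_nat (k * (3 * k choose k) * (2 * k choose k)) / 27 ^ k)
        (x ^ (k - 1) + of_int (Legendre (int p) 3) * (1 - x) ^ (k - 1)))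
      0 (of_nat p ^ 2) \<and>
    poly_cong
      (\<Sum>k = 1..p - 1. smult (of_nat (k * (4 * k choose (2 * k)) * (2 * k choose k)) / 64 ^ k)
        (x ^ (k - 1) + of_int (Legendre (- 2) (int p)) * (1 - x) ^ (k - 1)))
      0 (of_nat p ^ 2) \<and>
    poly_cong
      (\<Sum>k = 1..p - 1. smult (of_nat (k * (6 * k choose (3 * k)) * (3 * k choose k)) / 432 ^ k)
        (x ^ (k - 1) + of_int (Legendre (- 1) (int p)) * (1 - x) ^ (k - 1)))
      0 (of_nat p ^ 2)"
proof -
  have cop: "coprime n p" if "n \<in> {3, 4, 12}" for n
  proof -
    have "\<not> p dvd 2" "\<not> p dvd 3" using assms(2) by (auto dest: dvd_imp_le)
    then have "coprime p 2" "coprime p 3" using assms(1) prime_imp_coprime by blast+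
    then have "coprime p (2 ^ 2)" "coprime p (2 ^ 2 * 3)" "coprime p 3"
      by (simp_all only: coprime_power_right_iff coprime_mult_right_iff simp_thms)
    then show ?thesis using that by (auto simp: coprime_commute)
  qed
  obtain r3 s3 where r3: "r3 < p" "3 * r3 + 1 = p * s3" "Legendre (int p) 3 = (-1) ^ r3"
    using minus_third_residue assms by blast
  obtain r4 s4 where r4: "r4 < p" "4 * r4 + 1 = p * s4" "Legendre (- 2) (int p) = (-1) ^ r4"
    using minus_fourth_residue assms by blast
  obtain r6 s6 where r6: "r6 < p" "6 * r6 + 1 = p * s6" "Legendre (- 1) (int p) = (-1) ^ r6"
    using minus_sixth_residue assms by blast
  \<comment> \<open>The bases 27, 64 and 432 are d^2 e for (d, e) = (3, 3), (4, 4) and (6,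
    12).\<close>
  have M: "(of_nat (3 ^ 2 * 3) :: 'p padic_int) = 27" "(of_nat (4 ^ 2 * 4) :: 'p padic_int) = 64"
    "(of_nat (6 ^ 2 * 12) :: 'p padic_int) = 432"
    by simp_all
  note cong3 = padic_hypergeometric_poly_cong[OF assms(1-3) r3(1,2) _ cop binomial_3_2_factor, of x]
  note cong4 = padic_hypergeometric_poly_cong[OF assms(1-3) r4(1,2) _ cop binomial_4_2_factor, of x]
  note cong6 = padic_hypergeometric_poly_cong[OF assms(1-3) r6(1,2) _ cop binomial_6_3_factor, of x]
  show ?thesis
    \<comment> \<open>Reassociation groups the two binomials into \<open>N k\<close> behind the
      factor k.\<close>
    unfolding r3(3) r4(3) r6(3) mult.assoc[of _ "_ choose _"]
    by (intro conjI cong3[unfolded M] cong4[unfolded M] cong6[unfolded M]) simp_all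
qed

end
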